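(* Let $p$ be a prime. Up to affine transformations (elements of $AGL(2,p)$) there is a unique set $S\subseteq\mathbb{F}_p^2$ of size $\frac{p(p-1)}{2}$ which is equidistributed in exactly $p-2$ directions; that is, such a set exists, and any two such sets are images of each other under an element of $AGL(2,p)$. Moreover, every subset of $\mathbb{F}_p^2$ having exactly $3$ special directions can be transformed by an element of $AGL(2,p)$ to either $S$ or $S^c$, where $S^c=\mathbb{F}_p^2\setminus S$ is the complement of $S$.
   Context: $\mathbb{F}_p$ is the field with $p$ elements. A direction is an equivalence class of nonzero vectors of $\mathbb{F}_p^2$ under multiplication by nonzero scalars; there are $p+1$ directions, and each corresponds to a class of $p$ parallel affine lines. A set $S\subseteq\mathbb{F}_p^2$ is equidistributed in a direction if all $p$ lines parallel to that direction intersect $S$ in the same number of points. A direction is called special for $S$ if $S$ is not equidistributed in it. $AGL(2,p)$ is the group of invertible affine transformations of $\mathbb{F}_p^2$. *)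

theory Defs
  imports "HOL-Analysis.Cartesian_Space" "HOL-Computational_Algebra.Primes"
begin

definition proportional :: "(('a::field ^ 2) \<times> ('a ^ 2)) set" where
  "proportional = {(v, w). v \<noteq> 0 \<and> w \<noteq> 0 \<and> (\<exists>c. c \<noteq> 0 \<and> w = c *s v)}"

definition directions :: "('a::field ^ 2) set set" where
  "directions = (UNIV - {0}) // proportional"

definition parallel_lines :: "('a::field ^ 2) set \<Rightarrow> ('a ^ 2) set set" where
  "parallel_lines d = {range (\<lambda>t. x + t *s v) | x v. v \<in> d}"

definition equidistributed :: "('a::{field,finite} ^ 2) set \<Rightarrow> ('a ^ 2) set \<Rightarrow> bool" where
  "equidistributed S d \<longleftrightarrow>
     (\<forall>l \<in> parallel_lines d. \<forall>m \<in> parallel_lines d. card (S \<inter> l) = card (S \<inter> m))"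

definition equidistributed_directions :: "('a::{field,finite} ^ 2) set \<Rightarrow> ('a ^ 2) set set" where
  "equidistributed_directions S = {d \<in> directions. equidistributed S d}"

definition special_directions :: "('a::{field,finite} ^ 2) set \<Rightarrow> ('a ^ 2) set set" where
  "special_directions S = {d \<in> directions. \<not> equidistributed S d}"

definition AGL2 :: "('a::field ^ 2 \<Rightarrow> 'a ^ 2) set" where
  "AGL2 = {\<lambda>x. A *v x + b | A b. invertible A}"

end

(* Write f for the indicator function of T, p for the order of the field, and let T have three
   special directions. Adding up the point counts of T on the p+1 lines through a point P gives
   p f(P) + |T|, and the equidistributed directions contribute a constant. In affine coordinates
   whose special lines are x = const, y = const and x + y = const this reads
     p f(x,y) = N1(x) + N2(y) + c(x+y).
   Modulo p, N1 and N2 are hence affine functions with the same slope r, and r is nonzero. After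
   rescaling, N1(x) = x and N2(y) = y modulo p, so that the counts are the representatives in
   {0..p-1}, unless the lines x = 0 and y = 0 are full, in which case we pass to the complement.
   As f vanishes on x = 0, c(s) = -rep(s), so p f(x,y) = rep(x) + rep(y) - rep(x+y):
   f is the carry of the addition x + y. The same identity gives all line counts of the carry set
   S = {rep(x) + rep(y) >= p}, whose special directions are exactly the three above. S and its
   complement have different sizes. *)
theory Submission
  imports Defs
begin

subsection \<open>Representatives in the prime field\<close>

text \<open>Translation by 1 permutes the field, so adding 1 to every element leaves the total
  unchanged.\<close>

lemma of_nat_CARD_eq_0: "of_nat CARD('a::{field,finite}) = (0::'a)"
proof -
  have "(\<Sum>x::'a\<in>UNIV. x) = (\<Sum>x::'a\<in>UNIV. x + 1)"
    by (rule sum.reindex_bij_witness[of _ "\<lambda>x. x + 1" "\<lambda>x. x - 1"]) auto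
  also have "\<dots> = (\<Sum>x::'a\<in>UNIV. x) + of_nat CARD('a)"
    by (simp add: sum.distrib)
  finally show ?thesis by simp
qed

text \<open>Were \<open>n\<close> zero in the field but coprime to the prime order, a Bezout
  relation would give 0 = 1.\<close>

lemma of_nat_eq_0_iff_CARD_dvd:
  assumes "prime CARD('a::{field,finite})"
  shows "of_nat n = (0::'a) \<longleftrightarrow> CARD('a) dvd n"
proof
  assume n: "of_nat n = (0::'a)"
  show "CARD('a) dvd n"
  proof (rule ccontr)
    assume nd: "\<not> CARD('a) dvd n"
    then have "gcd n CARD('a) = 1"
      using assms by (metis coprime_iff_gcd_eq_1 prime_imp_coprime_nat coprime_commute)
    moreover have "n \<noteq> 0" using nd by (metis dvd_0_right)
    ultimately obtain x y where "n * x = CARD('a) * y + 1"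
      using bezout_nat[of n "CARD('a)"] by metis
    then have "of_nat (n * x) = (of_nat (CARD('a) * y + 1) :: 'a)" by simp
    then show False using n by (simp add: of_nat_CARD_eq_0)
  qed
next
  assume "CARD('a) dvd n"
  then show "of_nat n = (0::'a)" by (auto simp: of_nat_CARD_eq_0)
qed

lemma bij_betw_of_nat:
  assumes "prime CARD('a::{field,finite})"
  shows "bij_betw (of_nat :: nat \<Rightarrow> 'a) {..<CARD('a)} UNIV"
proof -
  have *: "m = n" if "m \<le> n" "n < CARD('a)" "of_nat m = (of_nat n :: 'a)" for m n
  proof -
    have "of_nat (n - m) = (0::'a)" using that by (simp add: of_nat_diff)
    then have "CARD('a) dvd n - m" using assms by (simp add: of_nat_eq_0_iff_CARD_dvd)
    then show "m = n" using that by (auto dest: dvd_imp_le)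
  qed
  have inj: "inj_on (of_nat :: nat \<Rightarrow> 'a) {..<CARD('a)}"
    by (rule inj_onI) (metis * lessThan_iff nat_le_linear)
  then have "of_nat ` {..<CARD('a)} = (UNIV :: 'a set)"
    by (intro card_subset_eq) (auto simp: card_image)
  with inj show ?thesis by (simp add: bij_betw_def)
qed

text \<open>The least nonnegative residue, meaningful when the field has prime order: only then does
  \<open>of_nat\<close> map \<open>{..<CARD('a)}\<close> onto the field.\<close>

definition rep :: "'a::{field,finite} \<Rightarrow> nat" where
  "rep = inv_into {..<CARD('a)} of_nat"

context
  assumes prime_card: "prime CARD('a::{field,finite})"
begin

lemma bij_betw_rep: "bij_betw (rep :: 'a \<Rightarrow> nat) UNIV {..<CARD('a)}"
  unfolding rep_def by (rule bij_betw_inv_into[OF bij_betw_of_nat[OF prime_card]])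

lemma rep_less: "rep (x::'a) < CARD('a)"
  using bij_betw_rep bij_betwE by blast

lemma of_nat_rep: "of_nat (rep x) = (x::'a)"
  unfolding rep_def using bij_betw_of_nat[OF prime_card] by (auto intro!: f_inv_into_f simp: bij_betw_def)

lemma rep_of_nat: "n < CARD('a) \<Longrightarrow> rep (of_nat n :: 'a) = n"
  unfolding rep_def using bij_betw_of_nat[OF prime_card] by (auto intro!: inv_into_f_f simp: bij_betw_def)

lemma rep_of_nat_mod: "rep (of_nat n :: 'a) = n mod CARD('a)"
proof -
  have "of_nat n = (of_nat (n mod CARD('a)) :: 'a)"
    using arg_cong[OF div_mult_mod_eq[of n "CARD('a)"], of "of_nat :: nat \<Rightarrow> 'a"]
    by (metis add_0 mult_zero_right of_nat_CARD_eq_0 of_nat_add of_nat_mult)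
  then show ?thesis using rep_of_nat[of "n mod CARD('a)"] by simp
qed

lemma rep_0 [simp]: "rep (0::'a) = 0"
  using rep_of_nat_mod[of 0] by simp

lemma rep_1: "rep (1::'a) = 1"
  using rep_of_nat_mod[of 1] prime_gt_1_nat[OF prime_card] by simp

text \<open>Two residues sum to less than twice the order, so reduction subtracts the order at most
  once; the \<open>of_bool\<close> term is the carry. All line counts of the carry set come from
  summing this identity.\<close>

lemma rep_add:
  "CARD('a) * of_bool (CARD('a) \<le> rep x + rep y) + rep (x + y) = rep x + rep (y::'a)"
proof -
  have "rep (x + y) = (rep x + rep y) mod CARD('a)"
    using rep_of_nat_mod[of "rep x + rep y"] by (simp add: of_nat_rep)
  then show ?thesis using rep_less[of x] rep_less[of y]
    by (cases "CARD('a) \<le> rep x + rep y") (simp_all add: le_mod_geq)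
qed

lemma sum_rep: "(\<Sum>x::'a\<in>UNIV. rep x) = CARD('a) * (CARD('a) - 1) div 2"
proof -
  have "(\<Sum>x::'a\<in>UNIV. rep x) = \<Sum>{..<CARD('a)}"
    using sum.reindex_bij_betw[OF bij_betw_rep, of "\<lambda>x. x"] by simp
  then show ?thesis by (simp add: lessThan_atLeast0 Sum_Ico_nat)
qed

text \<open>\<open>F x - F 0\<close> is additive, and every element of a prime field is a multiple
  of 1, so induction over the naturals suffices.\<close>

lemma affine_of_additive:
  fixes F :: "'a \<Rightarrow> 'a"
  assumes "\<And>x y. F (x + y) = F x + F y - F 0"
  shows "F x = F 0 + (F 1 - F 0) * x"
proof -
  have "F (of_nat n) = F 0 + (F 1 - F 0) * of_nat n" for n
  proof (induction n)
    case (Suc n)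
    have "F (of_nat (Suc n)) = F (1 + of_nat n)" by simp
    also have "\<dots> = F 1 + F (of_nat n) - F 0" by (rule assms)
    finally show ?case using Suc by (simp add: algebra_simps)
  qed simp
  from this[of "rep x"] show ?thesis by (simp add: of_nat_rep)
qed

subsection \<open>Indicator functions determined by line counts\<close>

text \<open>A count between 0 and p is fixed by its residue except for the ambiguity 0 versus p. The
  hypothesis \<open>empty\<close> settles it for both families of lines; \<open>eq\<close> along the
  empty line then yields \<open>c\<close>, and comparison with \<open>rep_add\<close> identifies
  \<open>f\<close>.\<close>

lemma carry_of_line_counts_empty:
  fixes f :: "'a \<Rightarrow> 'a \<Rightarrow> bool" and c :: "'a \<Rightarrow> int"
  assumes eq: "\<And>x y. int CARD('a) * of_bool (f x y) = int (card {y. f x y}) + int (card {x. f x y}) + c (x + y)"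
    and mod1: "\<And>x. of_nat (card {y. f x y}) = a + r * x"
    and mod2: "\<And>y. of_nat (card {x. f x y}) = b + r * y"
    and r: "r \<noteq> 0" and empty: "card {y. f (- (a / r)) y} = 0"
  shows "f x y \<longleftrightarrow> CARD('a) \<le> rep (a + r * x) + rep (b + r * y)"
proof -
  have le1: "card {y. f x y} \<le> CARD('a)" and le2: "card {x. f x y} \<le> CARD('a)" for x y
    by (auto intro: card_mono)
  have e: "\<not> f (- (a / r)) y" for y using empty by auto
  have c1: "card {y. f x y} = rep (a + r * x)" for x
  proof (cases "card {y. f x y} = CARD('a)")
    case True
    with mod1[of x] have "x = - (a / r)" using r
      by (simp add: of_nat_CARD_eq_0 field_simps) (metis add.commute add_eq_0_iff)
    with True empty show ?thesis by simp
  next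
    case False
    with le1[of x] show ?thesis using rep_of_nat[of "card {y. f x y}"] mod1[of x] by simp
  qed
  have c2: "card {x. f x y} = rep (b + r * y)" for y
  proof (cases "card {x. f x y} = CARD('a)")
    case True
    \<comment> \<open>A full line y = const would meet the empty line x = - (a / r).\<close>
    then have "{x. f x y} = UNIV" by (metis card_subset_eq finite subset_UNIV)
    with e show ?thesis by auto
  next
    case False
    with le2[of y] show ?thesis using rep_of_nat[of "card {x. f x y}"] mod2[of y] by simp
  qed
  \<comment> \<open>Evaluate \<open>eq\<close> at the point of the empty line with coordinate sum
    \<open>s\<close>: both the indicator and the first count vanish there.\<close>
  have c3: "c s = - int (rep (b + a + r * s))" for s
    using eq[of "- (a / r)" "s + a / r"] r
    by (simp add: e c2 empty algebra_simps del: card_eq_0_iff)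
  have "int CARD('a) * of_bool (f x y) = int (rep (a + r * x)) + int (rep (b + r * y)) - int (rep ((a + r * x) + (b + r * y)))"
    using eq[of x y] by (simp add: c1 c2 c3 algebra_simps)
  then have "CARD('a) * of_bool (f x y) + rep ((a + r * x) + (b + r * y)) = rep (a + r * x) + rep (b + r * y)"
    by (cases "f x y") auto
  with rep_add[of "a + r * x" "b + r * y"]
  have "CARD('a) * of_bool (f x y) = CARD('a) * of_bool (CARD('a) \<le> rep (a + r * x) + rep (b + r * y))"
    by linarith
  then show ?thesis by (simp add: of_bool_eq_iff)
qed

text \<open>Reducing \<open>eq\<close> modulo p kills the indicator and forces the counts to be
  affine with a common slope \<open>r\<close>. The line on which the first count vanishes modulo p
  is either empty or full; passing to the negation of \<open>f\<close> reduces the second case to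
  the first.\<close>

lemma carry_of_line_counts:
  fixes f :: "'a \<Rightarrow> 'a \<Rightarrow> bool" and c :: "'a \<Rightarrow> int"
  assumes eq: "\<And>x y. int CARD('a) * of_bool (f x y) = int (card {y. f x y}) + int (card {x. f x y}) + c (x + y)"
    and nc1: "\<exists>x x'. card {y. f x y} \<noteq> card {y. f x' y}"
    and nc2: "\<exists>y y'. card {x. f x y} \<noteq> card {x. f x y'}"
  shows "\<exists>r a b. r \<noteq> 0 \<and>
    ((\<forall>x y. f x y \<longleftrightarrow> CARD('a) \<le> rep (a + r * x) + rep (b + r * y)) \<or>
     (\<forall>x y. \<not> f x y \<longleftrightarrow> CARD('a) \<le> rep (a + r * x) + rep (b + r * y)))"
proof -
  define F where "F x = (of_nat (card {y. f x y}) :: 'a)" for x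
  define G where "G y = (of_nat (card {x. f x y}) :: 'a)" for y
  define H where "H s = (of_int (c s) :: 'a)" for s
  have FGH: "F x + G y + H (x + y) = 0" for x y
    using arg_cong[OF eq[of x y], of "of_int :: int \<Rightarrow> 'a"]
    by (simp add: F_def G_def H_def of_nat_CARD_eq_0)
  \<comment> \<open>The points (x, 0) and (0, x) have the same coordinate sum, so \<open>H\<close>
    cancels.\<close>
  have GF: "G x = F x + G 0 - F 0" for x
    using FGH[of x 0] FGH[of 0 x] by simp (metis add.commute add_diff_cancel_right' add_right_cancel)
  \<comment> \<open>Likewise for (x + y, 0) and (x, y).\<close>
  have add: "F (x + y) = F x + F y - F 0" for x y
  proof -
    have "F (x + y) + G 0 = F x + G y"
      using FGH[of "x + y" 0] FGH[of x y] by simp (metis add_right_cancel)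
    then show ?thesis unfolding GF[of y] by (simp add: algebra_simps)
  qed
  define r where "r = F 1 - F 0"
  have F: "F x = F 0 + r * x" for x
    unfolding r_def by (rule affine_of_additive[OF add])
  have G: "G x = G 0 + r * x" for x
    using GF[of x] F[of x] by simp
  have le1: "card {y. f x y} \<le> CARD('a)" and le2: "card {x. f x y} \<le> CARD('a)" for x y
    by (auto intro: card_mono)
  have zero: "n = 0 \<or> n = CARD('a)" if "n \<le> CARD('a)" "of_nat n = (0::'a)" for n
    using that of_nat_eq_0_iff_CARD_dvd[OF prime_card, of n] by (metis dvd_imp_le gr0I le_antisym)
  have zero1: "{y. f x y} = {} \<or> {y. f x y} = UNIV" if "F x = 0" for x
    using zero[OF le1[of x]] that unfolding F_def by (metis card_0_eq card_subset_eq finite subset_UNIV)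
  \<comment> \<open>If \<open>r = 0\<close>, nonconstant counts only take the values \<open>0\<close> and \<open>p\<close>; but a full line in one
    direction meets an empty line in the other.\<close>
  have r: "r \<noteq> 0"
  proof
    assume r0: "r = 0"
    have rg: "m = n \<or> (m = 0 \<and> n = CARD('a)) \<or> (m = CARD('a) \<and> n = 0)"
      if "of_nat m = (of_nat n :: 'a)" "m \<le> CARD('a)" "n \<le> CARD('a)" for m n
    proof -
      have "rep (of_nat m :: 'a) = rep (of_nat n :: 'a)" using that by simp
      then have "m mod CARD('a) = n mod CARD('a)" by (simp only: rep_of_nat_mod)
      then show ?thesis using that by (cases "m = CARD('a)"; cases "n = CARD('a)") auto
    qed
    have Fc: "F x = F x'" for x x' using F[of x] F[of x'] r0 by simp
    have Gc: "G x = G x'" for x x' using G[of x] G[of x'] r0 by simp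
    obtain x where "card {y. f x y} = CARD('a)"
      using nc1 rg[OF Fc[unfolded F_def] le1 le1] by metis
    then have "{y. f x y} = UNIV" by (metis card_subset_eq finite subset_UNIV)
    moreover obtain y where "card {x. f x y} = 0"
      using nc2 rg[OF Gc[unfolded G_def] le2 le2] by metis
    ultimately show False by auto
  qed
  show ?thesis
  proof (cases "{y. f (- (F 0 / r)) y} = {}")
    case True
    then have "card {y. f (- (F 0 / r)) y} = 0" by simp
    have F': "of_nat (card {y. f x y}) = F 0 + r * x" for x using F[of x] by (simp only: F_def)
    have G': "of_nat (card {x. f x y}) = G 0 + r * y" for y using G[of y] by (simp only: G_def)
    have "f x y \<longleftrightarrow> CARD('a) \<le> rep (F 0 + r * x) + rep (G 0 + r * y)" for x y
      by (rule carry_of_line_counts_empty[OF eq F' G' r]) fact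
    with r show ?thesis by blast
  next
    case False
    have "F (- (F 0 / r)) = 0" using F[of "- (F 0 / r)"] r by simp
    with False zero1 have full: "{y. f (- (F 0 / r)) y} = UNIV" by blast
    have k1: "card {y. \<not> f x y} = CARD('a) - card {y. f x y}" for x
      by (simp add: Collect_neg_eq Compl_eq_Diff_UNIV card_Diff_subset)
    have k2: "card {x. \<not> f x y} = CARD('a) - card {x. f x y}" for y
      by (simp add: Collect_neg_eq Compl_eq_Diff_UNIV card_Diff_subset)
    \<comment> \<open>Each count becomes p minus itself, which changes the signs of the intercepts
      and of the slope modulo p but leaves their quotient, hence the distinguished line, in
      place.\<close>
    have eq': "int CARD('a) * of_bool (\<not> f x y) = int (card {y. \<not> f x y}) + int (card {x. \<not> f x y}) + (- c (x + y) - int CARD('a))" for x y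
      using eq[of x y] le1[of x] le2[of y] by (auto simp: k1 k2 of_nat_diff)
    have F': "of_nat (card {y. \<not> f x y}) = - F 0 + (- r) * x" for x
      using F[of x] le1[of x] by (simp add: k1 of_nat_diff of_nat_CARD_eq_0 F_def)
    have G': "of_nat (card {x. \<not> f x y}) = - G 0 + (- r) * y" for y
      using G[of y] le2[of y] by (simp add: k2 of_nat_diff of_nat_CARD_eq_0 G_def)
    have "- r \<noteq> 0" and "card {y. \<not> f (- ((- F 0) / (- r))) y} = 0" using r full by auto
    then have "\<not> f x y \<longleftrightarrow> CARD('a) \<le> rep (- F 0 + (- r) * x) + rep (- G 0 + (- r) * y)" for x y
      by (rule carry_of_line_counts_empty[OF eq' F' G'])
    with \<open>- r \<noteq> 0\<close> show ?thesis by blast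
  qed
qed

end

subsection \<open>Directions and lines\<close>

text \<open>A direction is an equivalence class of nonzero vectors, so \<open>line P d\<close> is the
  line through \<open>P\<close> parallel to \<open>d\<close> only when \<open>d\<close> is a full class.\<close>

definition line :: "'a::field ^ 2 \<Rightarrow> ('a ^ 2) set \<Rightarrow> ('a ^ 2) set" where
  "line P d = insert P ((+) P ` d)"

text \<open>The class of a nonzero \<open>v\<close> under \<open>proportional\<close>; for
  \<open>v = 0\<close> it is \<open>{0}\<close>, which is not a direction.\<close>

definition direction :: "'a::field ^ 2 \<Rightarrow> ('a ^ 2) set" where
  "direction v = {c *s v | c. c \<noteq> 0}"

lemma equiv_proportional: "equiv (UNIV - {0}) (proportional :: (('a::field ^ 2) \<times> _) set)"
proof (rule equivI)
  show "refl_on (UNIV - {0}) (proportional :: (('a ^ 2) \<times> _) set)"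
    unfolding refl_on_def proportional_def by (auto intro!: exI[of _ 1])
  show "sym (proportional :: (('a ^ 2) \<times> _) set)"
  proof (rule symI)
    fix v w :: "'a ^ 2" assume "(v, w) \<in> proportional"
    then obtain c where "v \<noteq> 0" "w \<noteq> 0" "c \<noteq> 0" "w = c *s v" by (auto simp: proportional_def)
    then show "(w, v) \<in> proportional"
      by (auto simp: proportional_def intro!: exI[of _ "inverse c"])
  qed
  show "trans (proportional :: (('a ^ 2) \<times> _) set)"
  proof (rule transI)
    fix u v w :: "'a ^ 2" assume "(u, v) \<in> proportional" "(v, w) \<in> proportional"
    then obtain c d where "u \<noteq> 0" "w \<noteq> 0" "c \<noteq> 0" "v = c *s u" "d \<noteq> 0" "w = d *s v"
      by (auto simp: proportional_def)
    then show "(u, w) \<in> proportional"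
      by (auto simp: proportional_def intro!: exI[of _ "d * c"])
  qed
qed (auto simp: proportional_def)

lemma proportional_image_eq_direction: "v \<noteq> 0 \<Longrightarrow> proportional `` {v} = direction v"
  by (auto simp: proportional_def direction_def)

lemma directions_eq: "directions = direction ` (UNIV - {0})"
  unfolding directions_def quotient_def by (auto simp: proportional_image_eq_direction)

lemma direction_eq_iff:
  assumes "v \<noteq> 0" "w \<noteq> 0"
  shows "direction v = direction w \<longleftrightarrow> (\<exists>c. w = c *s v)"
proof -
  have "direction v = direction w \<longleftrightarrow> (v, w) \<in> proportional"
    using eq_equiv_class_iff[OF equiv_proportional, of v w] assms
    by (simp add: proportional_image_eq_direction)
  also have "\<dots> \<longleftrightarrow> (\<exists>c. w = c *s v)"
    using assms by (auto simp: proportional_def)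
  finally show ?thesis .
qed

lemma direction_scale: "c \<noteq> 0 \<Longrightarrow> v \<noteq> 0 \<Longrightarrow> direction (c *s v) = direction v"
  using direction_eq_iff[of v "c *s v"] by auto

lemma line_direction: "line P (direction v) = range (\<lambda>t. P + t *s v)"
proof (intro set_eqI iffI)
  fix Q assume "Q \<in> range (\<lambda>t. P + t *s v)"
  then obtain t where "Q = P + t *s v" by auto
  then show "Q \<in> line P (direction v)"
    by (cases "t = 0") (auto simp: line_def direction_def)
next
  fix Q assume "Q \<in> line P (direction v)"
  then show "Q \<in> range (\<lambda>t. P + t *s v)"
    by (auto simp: line_def direction_def intro: range_eqI[of _ _ 0])
qed

lemma line_direction_shift: "line (P + s *s v) (direction v) = line P (direction v)"
proof (intro set_eqI iffI)
  fix Q assume "Q \<in> line (P + s *s v) (direction v)"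
  then obtain t where "Q = P + s *s v + t *s v" by (auto simp: line_direction)
  then show "Q \<in> line P (direction v)"
    unfolding line_direction by (intro range_eqI[of _ _ "s + t"]) (simp add: vector_sadd_rdistrib)
next
  fix Q assume "Q \<in> line P (direction v)"
  then obtain t where "Q = P + t *s v" by (auto simp: line_direction)
  then show "Q \<in> line (P + s *s v) (direction v)"
    unfolding line_direction
    by (intro range_eqI[of _ _ "t - s"]) (simp add: vector_sub_rdistrib)
qed

lemma card_Int_line:
  fixes v :: "'a::{field,finite} ^ 2"
  assumes "v \<noteq> 0"
  shows "card (S \<inter> line P (direction v)) = card {t. P + t *s v \<in> S}"
proof -
  have "inj (\<lambda>t. P + t *s v)" using assms by (auto simp: inj_on_def)
  moreover have "S \<inter> line P (direction v) = (\<lambda>t. P + t *s v) ` {t. P + t *s v \<in> S}"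
    by (auto simp: line_direction)
  ultimately show ?thesis by (metis card_image inj_on_subset subset_UNIV)
qed

lemma parallel_lines_direction:
  assumes "v \<noteq> 0"
  shows "parallel_lines (direction v) = range (\<lambda>P. line P (direction v))"
proof -
  have "range (\<lambda>t. P + t *s w) = line P (direction v)" if "w \<in> direction v" for P w
    using that direction_scale[OF _ assms] by (auto simp: line_direction[symmetric] direction_def)
  moreover have "v \<in> direction v" by (auto simp: direction_def intro!: exI[of _ 1])
  ultimately show ?thesis unfolding parallel_lines_def by blast
qed

lemma equidistributed_direction_iff:
  assumes "v \<noteq> 0"
  shows "equidistributed S (direction v) \<longleftrightarrow>
    (\<forall>P Q. card (S \<inter> line P (direction v)) = card (S \<inter> line Q (direction v)))"
  unfolding equidistributed_def parallel_lines_direction[OF assms] by blast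

section \<open>Counting over the pencil of lines through a point\<close>

lemma sum_card_Int_directions:
  "(\<Sum>d\<in>directions. card (A \<inter> d)) = card (A - {0 :: 'a::{field,finite} ^ 2})"
proof -
  have "A - {0} = (\<Union>d\<in>directions. A \<inter> d)"
    using Union_quotient[OF equiv_proportional] unfolding directions_def by blast
  moreover have "card (\<Union>d\<in>directions. A \<inter> d) = (\<Sum>d\<in>directions. card (A \<inter> d))"
    by (rule card_UN_disjoint)
      (use quotient_disj[OF equiv_proportional] in \<open>auto simp: directions_def\<close>)
  ultimately show ?thesis by simp
qed

lemma card_direction:
  fixes v :: "'a::{field,finite} ^ 2"
  assumes "v \<noteq> 0"
  shows "card (direction v) = CARD('a) - 1"
proof -
  have "direction v = (\<lambda>c. c *s v) ` (UNIV - {0})" by (auto simp: direction_def)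
  moreover have "inj (\<lambda>c. c *s v)" using assms by (auto simp: inj_on_def)
  ultimately show ?thesis
    by (metis card_Diff_singleton card_image finite inj_on_subset iso_tuple_UNIV_I subset_UNIV)
qed

lemma card_field_ge_2: "CARD('a::{field,finite}) \<ge> 2"
proof -
  have "card {0, 1::'a} \<le> CARD('a)" by (rule card_mono) auto
  then show ?thesis by simp
qed

text \<open>The p^2 - 1 nonzero vectors split into classes of size p - 1.\<close>

lemma card_directions: "card (directions :: ('a::{field,finite} ^ 2) set set) = CARD('a) + 1"
proof -
  obtain n where n: "CARD('a) = Suc (Suc n)"
    using card_field_ge_2[where 'a='a] by (metis add_2_eq_Suc le_Suc_ex)
  have "card (directions :: ('a ^ 2) set set) * (CARD('a) - 1) = (\<Sum>d\<in>(directions :: ('a ^ 2) set set). CARD('a) - 1)"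
    by simp
  also have "\<dots> = (\<Sum>d\<in>(directions :: ('a ^ 2) set set). card d)"
  proof (rule sum.cong)
    fix d :: "('a ^ 2) set" assume "d \<in> directions"
    then obtain v where "v \<noteq> 0" "d = direction v" by (auto simp: directions_eq)
    then show "CARD('a) - 1 = card d" by (simp add: card_direction)
  qed simp
  also have "\<dots> = CARD('a) * CARD('a) - 1"
    using sum_card_Int_directions[of "UNIV :: ('a ^ 2) set"] by (simp add: card_Diff_singleton power2_eq_square)
  finally have "card (directions :: ('a ^ 2) set set) * Suc n = Suc (Suc (Suc n)) * Suc n"
    by (simp add: n)
  then show ?thesis unfolding n by (simp only: mult_cancel2) simp
qed

text \<open>Every point other than \<open>P\<close> lies on exactly one line through
  \<open>P\<close>, while \<open>P\<close> lies on all p + 1 of them. The proof translates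
  \<open>P\<close> to the origin, where the directions partition the nonzero vectors.\<close>

lemma sum_card_Int_line:
  "(\<Sum>d\<in>directions. card (S \<inter> line P d)) = CARD('a) * of_bool (P \<in> S) + card (S :: ('a::{field,finite} ^ 2) set)"
proof -
  have *: "card (S \<inter> line P d) = of_bool (P \<in> S) + card ((+) (- P) ` S \<inter> d)" if "d \<in> directions" for d
  proof -
    have "0 \<notin> d" using that by (auto simp: directions_eq direction_def)
    then have "P \<notin> (+) P ` d" by auto
    moreover have "S \<inter> (+) P ` d = (+) P ` ((+) (- P) ` S \<inter> d)"
      by (force simp: image_iff)
    then have "card (S \<inter> (+) P ` d) = card ((+) (- P) ` S \<inter> d)" by (simp add: card_image)
    moreover have "S \<inter> line P d = (if P \<in> S then insert P (S \<inter> (+) P ` d) else S \<inter> (+) P ` d)"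
      by (auto simp: line_def)
    ultimately show ?thesis by simp
  qed
  have "(\<Sum>d\<in>directions. card (S \<inter> line P d)) = (CARD('a) + 1) * of_bool (P \<in> S) + card ((+) (- P) ` S - {0})"
    using sum_card_Int_directions[of "(+) (- P) ` S"] by (simp add: * sum.distrib card_directions)
  also have "(+) (- P) ` S - {0} = (+) (- P) ` (S - {P})" by auto
  also have "card \<dots> = card (S - {P})" by (simp add: card_image)
  also have "(CARD('a) + 1) * of_bool (P \<in> S) + \<dots> = CARD('a) * of_bool (P \<in> S) + card S"
    using card.remove[of S P] by (cases "P \<in> S") simp_all
  finally show ?thesis .
qed

lemma card_equidistributed_plus_special:
  "card (equidistributed_directions S) + card (special_directions (S :: ('a::{field,finite} ^ 2) set)) = CARD('a) + 1"
proof -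
  have "equidistributed_directions S \<union> special_directions S = directions"
    and "equidistributed_directions S \<inter> special_directions S = {}"
    by (auto simp: equidistributed_directions_def special_directions_def)
  then show ?thesis
    by (metis card_Un_disjoint card_directions finite)
qed

subsection \<open>Affine maps\<close>

lemma AGL2_bij:
  fixes g :: "'a::field ^ 2 \<Rightarrow> 'a ^ 2"
  assumes "g \<in> AGL2" shows "bij g"
proof -
  obtain A b where g: "g = (\<lambda>x. A *v x + b)" "invertible A" using assms by (auto simp: AGL2_def)
  then obtain B where B: "A ** B = mat 1" "B ** A = mat 1" by (auto simp: invertible_def)
  show ?thesis
    by (rule bij_betw_byWitness[where f' = "\<lambda>y. B *v (y - b)"])
      (auto simp: g B matrix_vector_mul_assoc)
qed

lemma AGL2_inv:
  fixes g :: "'a::field ^ 2 \<Rightarrow> 'a ^ 2"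
  assumes "g \<in> AGL2" shows "inv g \<in> AGL2"
proof -
  obtain A b where g: "g = (\<lambda>x. A *v x + b)" "invertible A" using assms by (auto simp: AGL2_def)
  then obtain B where B: "A ** B = mat 1" "B ** A = mat 1" by (auto simp: invertible_def)
  have "inv g = (\<lambda>y. B *v y + - (B *v b))"
    by (rule inv_unique_comp)
      (auto simp: g B fun_eq_iff matrix_vector_mul_assoc matrix_vector_right_distrib matrix_vector_mult_diff_distrib)
  moreover have "invertible B" using B by (auto simp: invertible_def)
  ultimately show ?thesis unfolding AGL2_def by blast
qed

lemma AGL2_comp:
  fixes g h :: "'a::field ^ 2 \<Rightarrow> 'a ^ 2"
  assumes "g \<in> AGL2" "h \<in> AGL2" shows "g \<circ> h \<in> AGL2"
proof -
  obtain A b where g: "g = (\<lambda>x. A *v x + b)" "invertible A" using assms by (auto simp: AGL2_def)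
  obtain B c where h: "h = (\<lambda>x. B *v x + c)" "invertible B" using assms by (auto simp: AGL2_def)
  have "g \<circ> h = (\<lambda>x. (A ** B) *v x + (A *v c + b))"
    by (auto simp: g h fun_eq_iff matrix_vector_mul_assoc matrix_vector_right_distrib)
  moreover have "invertible (A ** B)" using g h by (simp add: invertible_mult)
  ultimately show ?thesis unfolding AGL2_def by blast
qed

text \<open>The matrix has columns \<open>e1\<close> and \<open>e2\<close>; their independence says
  that its kernel is trivial.\<close>

lemma affine_map_in_AGL2:
  fixes e1 e2 c :: "'a::field ^ 2"
  assumes "\<And>x y. x *s e1 + y *s e2 = 0 \<Longrightarrow> x = 0 \<and> y = 0"
  shows "(\<lambda>v. v$1 *s e1 + v$2 *s e2 + c) \<in> AGL2"
proof -
  define A :: "'a ^ 2 ^ 2" where "A = (\<chi> i j. if j = 1 then e1$i else e2$i)"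
  have A: "A *v v = v$1 *s e1 + v$2 *s e2" for v
    by (simp add: A_def matrix_vector_mult_def vec_eq_iff sum_2 mult.commute)
  have "v = 0" if "A *v v = 0" for v
    using assms[of "v$1" "v$2"] that unfolding A by (simp add: vec_eq_iff[of v] forall_2)
  then have "invertible A"
    unfolding invertible_left_inverse matrix_left_invertible_ker by blast
  then show ?thesis unfolding AGL2_def A[symmetric] by blast
qed

subsection \<open>The carry set\<close>

text \<open>The model set: the points whose coordinates, added as residues, produce a carry.\<close>

definition carry_set :: "('a::{field,finite} ^ 2) set" where
  "carry_set = {v. CARD('a) \<le> rep (v$1) + rep (v$2)}"

lemma card_Collect_eq_sum: "card {t::'a::finite. Q t} = (\<Sum>t\<in>UNIV. of_bool (Q t))"
  by (simp add: sum.If_cases of_bool_def)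

context
  assumes prime_card: "prime CARD('a::{field,finite})"
begin

lemma sum_rep_affine:
  "(\<Sum>t\<in>UNIV. rep ((a :: 'a) + t * k)) = (if k = 0 then CARD('a) * rep a else \<Sum>x\<in>UNIV. rep (x::'a))"
proof (cases "k = 0")
  case False
  have "(\<Sum>t\<in>UNIV. rep (a + t * k)) = (\<Sum>x::'a\<in>UNIV. rep x)"
    by (rule sum.reindex_bij_witness[of _ "\<lambda>x. (x - a) / k" "\<lambda>t. a + t * k"]) (use False in auto)
  with False show ?thesis by simp
qed simp

text \<open>This is \<open>rep_add\<close> summed along a line, on which both coordinates and their
  sum are affine functions of the parameter.\<close>

lemma card_carry_set_Int_line:
  assumes "v \<noteq> 0"
  shows "CARD('a) * card (carry_set \<inter> line P (direction v)) + (\<Sum>t\<in>UNIV. rep (P$1 + P$2 + t * (v$1 + v$2)))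
    = (\<Sum>t\<in>UNIV. rep (P$1 + t * v$1)) + (\<Sum>t\<in>UNIV. rep (P$2 + t * (v$2 :: 'a)))"
proof -
  have "CARD('a) * of_bool (P + t *s v \<in> carry_set) + rep (P$1 + P$2 + t * (v$1 + v$2))
    = rep (P$1 + t * v$1) + rep (P$2 + t * v$2)" for t
    using rep_add[OF prime_card, of "P$1 + t * v$1" "P$2 + t * v$2"]
    by (simp add: carry_set_def algebra_simps)
  then have "(\<Sum>t\<in>UNIV. CARD('a) * of_bool (P + t *s v \<in> carry_set) + rep (P$1 + P$2 + t * (v$1 + v$2)))
    = (\<Sum>t\<in>UNIV. rep (P$1 + t * v$1) + rep (P$2 + t * v$2))" by simp
  then show ?thesis
    unfolding card_Int_line[OF assms] card_Collect_eq_sum by (simp add: sum.distrib sum_distrib_left mult.commute)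
qed

text \<open>A coordinate function that is nonconstant along the line runs through the whole field
  and contributes the same total on every parallel line; a constant one contributes p times its
  residue, which varies with the line.\<close>

lemma equidistributed_carry_set_iff:
  assumes "(v :: 'a ^ 2) \<noteq> 0"
  shows "equidistributed carry_set (direction v) \<longleftrightarrow> v$1 \<noteq> 0 \<and> v$2 \<noteq> 0 \<and> v$1 + v$2 \<noteq> 0"
proof
  assume "v$1 \<noteq> 0 \<and> v$2 \<noteq> 0 \<and> v$1 + v$2 \<noteq> 0"
  then have "CARD('a) * card (carry_set \<inter> line P (direction v)) = (\<Sum>x\<in>UNIV. rep (x::'a))" for P
    using card_carry_set_Int_line[OF assms, of P] by (simp add: sum_rep_affine)
  then show "equidistributed carry_set (direction v)"
    unfolding equidistributed_direction_iff[OF assms] by (metis mult_cancel1 zero_less_card_finite less_irrefl)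
next
  assume "equidistributed carry_set (direction v)"
  then have eq: "card (carry_set \<inter> line 0 (direction v)) = card (carry_set \<inter> line P (direction v))" for P
    unfolding equidistributed_direction_iff[OF assms] by blast
  define N where "N = card (carry_set \<inter> line 0 (direction v))"
  have N: "card (carry_set \<inter> line P (direction v)) = N" for P
    using eq[of P] by (simp add: N_def)
  note counts = card_carry_set_Int_line[OF assms, unfolded sum_rep_affine N]
  \<comment> \<open>These three base points suffice: each of the functions x, y and x + y takes both
    values 0 and 1 among them.\<close>
  note c0 = counts[of 0] and c1 = counts[of "vector [1, 0]"] and c2 = counts[of "vector [0, 1]"]
  have "v$1 \<noteq> 0 \<or> v$2 \<noteq> 0" using assms by (auto simp: vec_eq_iff forall_2)
  then show "v$1 \<noteq> 0 \<and> v$2 \<noteq> 0 \<and> v$1 + v$2 \<noteq> 0"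
    using c0 c1 c2 by (auto simp: vector_2 rep_0[OF prime_card] rep_1[OF prime_card] split: if_splits)
qed

lemma special_directions_carry_set:
  "special_directions (carry_set :: ('a ^ 2) set) =
    {direction (vector [0, 1]), direction (vector [1, 0]), direction (vector [1, - 1])}"
proof -
  define e1 e2 e3 :: "'a ^ 2" where "e1 = vector [0, 1]" and "e2 = vector [1, 0]" and "e3 = vector [1, - 1]"
  have nz: "e1 \<noteq> 0" "e2 \<noteq> 0" "e3 \<noteq> 0" by (auto simp: e1_def e2_def e3_def vec_eq_iff forall_2)
  have "direction v \<in> {direction e1, direction e2, direction e3} \<longleftrightarrow> v$1 = 0 \<or> v$2 = 0 \<or> v$1 + v$2 = 0"
    if "v \<noteq> 0" for v
  proof -
    have "(\<exists>c. v = c *s e1) \<longleftrightarrow> v$1 = 0" "(\<exists>c. v = c *s e2) \<longleftrightarrow> v$2 = 0"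
      "(\<exists>c. v = c *s e3) \<longleftrightarrow> v$1 + v$2 = 0"
      by (auto simp: e1_def e2_def e3_def vec_eq_iff forall_2 add_eq_0_iff)
    then show ?thesis using direction_eq_iff[OF _ that] nz by blast
  qed
  note mem = this
  have "\<not> equidistributed carry_set d \<longleftrightarrow> d \<in> {direction e1, direction e2, direction e3}"
    if d: "d \<in> directions" for d
  proof -
    obtain v where v: "v \<noteq> 0" "d = direction v" using d by (auto simp: directions_eq)
    then show ?thesis using mem[OF v(1)] equidistributed_carry_set_iff[OF v(1)] by metis
  qed
  moreover have "{direction e1, direction e2, direction e3} \<subseteq> directions"
    using nz by (auto simp: directions_eq)
  ultimately show ?thesis unfolding special_directions_def e1_def[symmetric] e2_def[symmetric] e3_def[symmetric]
    by blast
qed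

lemma card_special_directions_carry_set: "card (special_directions (carry_set :: ('a ^ 2) set)) = 3"
proof -
  define e1 e2 e3 :: "'a ^ 2" where "e1 = vector [0, 1]" and "e2 = vector [1, 0]" and "e3 = vector [1, - 1]"
  have nz: "e1 \<noteq> 0" "e2 \<noteq> 0" "e3 \<noteq> 0" by (auto simp: e1_def e2_def e3_def vec_eq_iff forall_2)
  have "direction e1 \<noteq> direction e2" "direction e1 \<noteq> direction e3" "direction e2 \<noteq> direction e3"
    unfolding direction_eq_iff[OF nz(1,2)] direction_eq_iff[OF nz(1,3)] direction_eq_iff[OF nz(2,3)]
    by (auto simp: e1_def e2_def e3_def vec_eq_iff forall_2)
  then show ?thesis unfolding special_directions_carry_set e1_def[symmetric] e2_def[symmetric] e3_def[symmetric]
    by simp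
qed

lemma card_carry_set: "card (carry_set :: ('a ^ 2) set) = CARD('a) * (CARD('a) - 1) div 2"
proof -
  \<comment> \<open>Sum \<open>rep_add\<close> over \<open>y\<close>: the totals of
    \<open>rep (x + y)\<close> and \<open>rep y\<close> cancel.\<close>
  have row: "card {y :: 'a. CARD('a) \<le> rep x + rep y} = rep x" for x :: 'a
  proof -
    have "(\<Sum>y\<in>UNIV. CARD('a) * of_bool (CARD('a) \<le> rep x + rep y) + rep (x + y)) = (\<Sum>y::'a\<in>UNIV. rep x + rep y)"
      by (simp add: rep_add[OF prime_card])
    then have "CARD('a) * card {y :: 'a. CARD('a) \<le> rep x + rep y} = CARD('a) * rep x"
      using sum_rep_affine[of x 1] unfolding card_Collect_eq_sum by (simp add: sum.distrib sum_distrib_left mult.commute)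
    then show ?thesis by simp
  qed
  have "bij_betw (\<lambda>v::'a ^ 2. (v$1, v$2)) carry_set (SIGMA x:UNIV. {y. CARD('a) \<le> rep x + rep y})"
    by (rule bij_betw_byWitness[where f' = "\<lambda>(x, y). vector [x, y]"])
      (auto simp: carry_set_def vec_eq_iff forall_2)
  then have "card (carry_set :: ('a ^ 2) set) = (\<Sum>x::'a\<in>UNIV. rep x)"
    by (simp add: bij_betw_same_card row)
  then show ?thesis by (simp add: sum_rep[OF prime_card])
qed

subsection \<open>Sets with three special directions\<close>

text \<open>Representatives of two special directions form a basis; rescaling them makes the third
  direction that of \<open>e1 - e2\<close>, so that its lines are x + y = const in the new
  coordinates.\<close>

lemma special_direction_coordinates:
  fixes T :: "('a ^ 2) set"
  assumes "card (special_directions T) = 3"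
  obtains e1 e2 where "e1 \<noteq> 0" "e2 \<noteq> 0" "e1 - e2 \<noteq> 0"
    "special_directions T = {direction e1, direction e2, direction (e1 - e2)}"
    "card {direction e1, direction e2, direction (e1 - e2)} = 3"
    "\<And>x y. x *s e1 + y *s e2 = 0 \<Longrightarrow> x = 0 \<and> y = 0"
    "\<And>v. \<exists>x y. v = x *s e1 + y *s e2"
proof -
  obtain d1 d2 d3 where d: "special_directions T = {d1, d2, d3}" "d1 \<noteq> d2" "d1 \<noteq> d3" "d2 \<noteq> d3"
    using assms unfolding card_3_iff by metis
  then have "d1 \<in> directions" "d2 \<in> directions" "d3 \<in> directions"
    unfolding special_directions_def by blast+
  then obtain v1 v2 v3 where v: "v1 \<noteq> 0" "v2 \<noteq> 0" "v3 \<noteq> 0"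
    "d1 = direction v1" "d2 = direction v2" "d3 = direction v3"
    unfolding directions_eq by blast
  have indep: "x = 0 \<and> y = 0" if e: "x *s v1 + y *s v2 = 0" for x y
  proof (cases "y = 0")
    case True
    with e v show ?thesis by simp
  next
    case False
    have "y *s v2 = (- x) *s v1" using e by (metis add.commute add_eq_0_iff vector_smult_lneg)
    then have "inverse y *s (y *s v2) = inverse y *s ((- x) *s v1)" by simp
    then have "v2 = (inverse y * (- x)) *s v1" using False by (simp add: vector_smult_assoc)
    with d v direction_eq_iff[OF v(1,2)] show ?thesis by blast
  qed
  have "inj (\<lambda>(x, y). x *s v1 + y *s v2)"
  proof (rule injI, clarify)
    fix x y x' y' assume "x *s v1 + y *s v2 = x' *s v1 + y' *s v2"
    then have "(x - x') *s v1 + (y - y') *s v2 = 0" by (simp add: vector_sub_rdistrib algebra_simps)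
    then show "x = x' \<and> y = y'" using indep by fastforce
  qed
  \<comment> \<open>An injective map between sets of size p^2 is onto.\<close>
  then have "range (\<lambda>(x, y). x *s v1 + y *s v2) = UNIV"
    by (intro card_subset_eq) (simp_all add: card_image card_prod power2_eq_square)
  then have span: "\<exists>x y. v = x *s v1 + y *s v2" for v
    by (metis (mono_tags, lifting) UNIV_I imageE case_prod_unfold)
  then obtain a b where ab: "v3 = a *s v1 + b *s v2" by blast
  have "b \<noteq> 0" using d v ab direction_eq_iff[OF v(1,3)] by auto
  have "a \<noteq> 0" using d v ab direction_eq_iff[OF v(2,3)] by auto
  define e1 e2 where "e1 = a *s v1" and "e2 = (- b) *s v2"
  have e12: "e1 - e2 = v3" by (simp add: e1_def e2_def ab)
  have dirs: "direction e1 = d1" "direction e2 = d2" "direction (e1 - e2) = d3"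
    using v \<open>a \<noteq> 0\<close> \<open>b \<noteq> 0\<close> direction_scale[of a v1] direction_scale[of "- b" v2]
    unfolding e12 unfolding e1_def e2_def by simp_all
  show thesis
  proof
    show "e1 \<noteq> 0" "e2 \<noteq> 0" "e1 - e2 \<noteq> 0" using v \<open>a \<noteq> 0\<close> \<open>b \<noteq> 0\<close> unfolding e12 by (auto simp: e1_def e2_def)
    show "special_directions T = {direction e1, direction e2, direction (e1 - e2)}" unfolding dirs d ..
    show "card {direction e1, direction e2, direction (e1 - e2)} = 3" using d unfolding dirs by simp
  next
    fix x y assume "x *s e1 + y *s e2 = 0"
    then have "(x * a) *s v1 + (y * (- b)) *s v2 = 0" by (simp add: e1_def e2_def vector_smult_assoc)
    from indep[OF this] show "x = 0 \<and> y = 0" using \<open>a \<noteq> 0\<close> \<open>b \<noteq> 0\<close> by simp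
  next
    fix v
    obtain x y where "v = x *s v1 + y *s v2" using span by blast
    then have "v = (x / a) *s e1 + (- (y / b)) *s e2" using \<open>a \<noteq> 0\<close> \<open>b \<noteq> 0\<close>
      by (simp add: e1_def e2_def vector_smult_assoc)
    then show "\<exists>x y. v = x *s e1 + y *s e2" by blast
  qed
qed

text \<open>In adapted coordinates the pencil count at a point becomes the equation required by
  \<open>carry_of_line_counts\<close>; the resulting affine change of coordinates is then
  inverted.\<close>

lemma three_special_directions:
  fixes T :: "('a ^ 2) set"
  assumes "card (special_directions T) = 3"
  shows "\<exists>g\<in>AGL2. g ` carry_set = T \<or> g ` carry_set = - T"
proof -
  obtain e1 e2 where nz: "e1 \<noteq> 0" "e2 \<noteq> 0" "e1 - e2 \<noteq> 0"
    and spec: "special_directions T = {direction e1, direction e2, direction (e1 - e2)}"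
    and card3: "card {direction e1, direction e2, direction (e1 - e2)} = 3"
    and indep: "\<And>x y. x *s e1 + y *s e2 = 0 \<Longrightarrow> x = 0 \<and> y = 0"
    and span: "\<And>v. \<exists>x y. v = x *s e1 + y *s e2"
    using special_direction_coordinates[OF assms] by blast
  define f where "f x y \<longleftrightarrow> x *s e1 + y *s e2 \<in> T" for x y
  \<comment> \<open>Moving along \<open>e2\<close> fixes the first coordinate, so the lines x =
    const belong to \<open>e2\<close> and the lines y = const to \<open>e1\<close>.\<close>
  have N1: "card (T \<inter> line (x *s e1 + y *s e2) (direction e2)) = card {y. f x y}" for x y
    unfolding line_direction_shift card_Int_line[OF nz(2)] f_def ..
  have N2: "card (T \<inter> line (x *s e1 + y *s e2) (direction e1)) = card {x. f x y}" for x y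
    unfolding add.commute[of "x *s e1"] line_direction_shift card_Int_line[OF nz(1)] f_def
    by (simp only: add.commute)
  define N3 where "N3 s = card (T \<inter> line (s *s e1) (direction (e1 - e2)))" for s
  have N3: "card (T \<inter> line (x *s e1 + y *s e2) (direction (e1 - e2))) = N3 (x + y)" for x y
  proof -
    have "x *s e1 + y *s e2 = (x + y) *s e1 + (- y) *s (e1 - e2)"
      by (simp add: vec_eq_iff algebra_simps)
    then show ?thesis unfolding N3_def by (simp only: line_direction_shift)
  qed
  define E where "E = directions - special_directions T"
  define K where "K = (\<Sum>d\<in>E. card (T \<inter> line 0 d))"
  have K: "(\<Sum>d\<in>E. card (T \<inter> line P d)) = K" for P
    unfolding K_def
  proof (rule sum.cong)
    fix d assume "d \<in> E"
    then obtain v where "v \<noteq> 0" "d = direction v" "equidistributed T d"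
      by (auto simp: E_def special_directions_def directions_eq)
    then show "card (T \<inter> line P d) = card (T \<inter> line 0 d)"
      using equidistributed_direction_iff by blast
  qed simp
  \<comment> \<open>Sum the line counts over all directions: the non-special ones contribute a constant.\<close>
  have eq: "int CARD('a) * of_bool (f x y) = int (card {y. f x y}) + int (card {x. f x y})
      + (\<lambda>s. int (N3 s) + int K - int (card T)) (x + y)" for x y
  proof -
    let ?P = "x *s e1 + y *s e2"
    have "special_directions T \<subseteq> directions" by (auto simp: special_directions_def)
    from sum.subset_diff[OF this finite, of "\<lambda>d. card (T \<inter> line ?P d)"] have "(\<Sum>d\<in>directions. card (T \<inter> line ?P d)) = (\<Sum>d\<in>special_directions T. card (T \<inter> line ?P d)) + K"
      unfolding E_def[symmetric] K by simp
    also have "(\<Sum>d\<in>special_directions T. card (T \<inter> line ?P d)) =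
        card (T \<inter> line ?P (direction e1)) + (card (T \<inter> line ?P (direction e2)) + card (T \<inter> line ?P (direction (e1 - e2))))"
    proof -
      have "direction e1 \<noteq> direction e2" "direction e1 \<noteq> direction (e1 - e2)" "direction e2 \<noteq> direction (e1 - e2)"
        using card3 by (auto simp: card_insert_if split: if_splits)
      then show ?thesis unfolding spec by simp
    qed
    finally have "CARD('a) * of_bool (f x y) + card T = card {x. f x y} + (card {y. f x y} + N3 (x + y)) + K"
      unfolding sum_card_Int_line N1 N2 N3 f_def[symmetric] .
    then show ?thesis by (cases "f x y") auto
  qed
  have nonconst: "\<exists>P Q. card (T \<inter> line P (direction v)) \<noteq> card (T \<inter> line Q (direction v))"
    if "direction v \<in> special_directions T" "v \<noteq> 0" for v
    using that unfolding special_directions_def by (auto simp: equidistributed_direction_iff)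
  have nc1: "\<exists>x x'. card {y. f x y} \<noteq> card {y. f x' y}"
    using nonconst[of e2] spec nz span N1 by (metis insertCI)
  have nc2: "\<exists>y y'. card {x. f x y} \<noteq> card {x. f x y'}"
    using nonconst[of e1] spec nz span N2 by (metis insertCI)
  obtain r a b where r: "r \<noteq> 0" and carry:
    "(\<forall>x y. f x y \<longleftrightarrow> CARD('a) \<le> rep (a + r * x) + rep (b + r * y)) \<or>
     (\<forall>x y. \<not> f x y \<longleftrightarrow> CARD('a) \<le> rep (a + r * x) + rep (b + r * y))"
    using carry_of_line_counts[OF prime_card eq nc1 nc2] by blast
  \<comment> \<open>\<open>g\<close> solves v$1 = a + r * x and v$2 = b + r * y for the coordinates
    x, y of its value with respect to \<open>e1\<close>, \<open>e2\<close>.\<close>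
  define g :: "'a ^ 2 \<Rightarrow> 'a ^ 2"
    where "g = (\<lambda>v. v$1 *s (inverse r *s e1) + v$2 *s (inverse r *s e2) + ((- (a / r)) *s e1 + (- (b / r)) *s e2))"
  have g: "g v = ((v$1 - a) / r) *s e1 + ((v$2 - b) / r) *s e2" for v
    by (simp add: g_def vec_eq_iff divide_inverse algebra_simps)
  have "g \<in> AGL2" unfolding g_def
  proof (rule affine_map_in_AGL2)
    fix x y assume "x *s (inverse r *s e1) + y *s (inverse r *s e2) = 0"
    then show "x = 0 \<and> y = 0" using indep[of "x * inverse r" "y * inverse r"] r by (simp add: vector_smult_assoc)
  qed
  have mem: "g v \<in> T \<longleftrightarrow> f ((v$1 - a) / r) ((v$2 - b) / r)" for v
    by (simp add: g f_def)
  have "a + r * ((x - a) / r) = x" "b + r * ((x - b) / r) = x" for x using r by simp_all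
  with carry have "(\<forall>v. g v \<in> T \<longleftrightarrow> v \<in> carry_set) \<or> (\<forall>v. g v \<in> - T \<longleftrightarrow> v \<in> carry_set)"
    unfolding mem carry_set_def Compl_iff mem_Collect_eq by metis
  then have "carry_set = g -` T \<or> carry_set = g -` (- T)" by blast
  moreover have "surj g" using AGL2_bij[OF \<open>g \<in> AGL2\<close>] by (rule bij_is_surj)
  ultimately have "g ` carry_set = T \<or> g ` carry_set = - T"
    by (metis surj_image_vimage_eq)
  with \<open>g \<in> AGL2\<close> show ?thesis by blast
qed

text \<open>With p + 1 directions in all, p - 2 equidistributed ones leave three special ones. The
  complement is ruled out by size: it would force 2 |S| = p^2, but 2 |S| is at most p (p -
  1).\<close>

lemma AGL2_image_of_carry_set:
  fixes S :: "('a ^ 2) set"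
  assumes "card S = CARD('a) * (CARD('a) - 1) div 2" "card (equidistributed_directions S) = CARD('a) - 2"
  shows "\<exists>g\<in>AGL2. g ` carry_set = S"
proof -
  have p: "CARD('a) \<ge> 2" by (rule card_field_ge_2)
  have "card (special_directions S) = 3"
    using card_equidistributed_plus_special[of S] assms(2) p by linarith
  then obtain g where g: "g \<in> AGL2" "g ` carry_set = S \<or> g ` carry_set = - S"
    using three_special_directions by blast
  have "g ` carry_set \<noteq> - S"
  proof
    assume "g ` carry_set = - S"
    then have "card (- S) = card (carry_set :: ('a ^ 2) set)"
      using AGL2_bij[OF g(1)] by (metis bij_is_inj card_image inj_on_subset subset_UNIV)
    then have "card S + card S = CARD('a) * CARD('a)"
      using card_Un_disjoint[of S "- S"] assms(1) by (simp add: card_carry_set power2_eq_square)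
    moreover have "card S + card S \<le> CARD('a) * (CARD('a) - 1)" using assms(1) by simp
    ultimately show False using p by simp
  qed
  with g show ?thesis by blast
qed

end

text \<open>All three claims pass through \<open>carry_set\<close>: it witnesses existence, and any
  two of its images under \<open>AGL2\<close> are related by composing one map with the inverse of
  the other.\<close>

theorem theorem1p1:
  fixes p :: nat
  assumes "prime p" and "CARD('a::{field,finite}) = p"
  shows "(\<exists>S :: ('a ^ 2) set.
            card S = p * (p - 1) div 2 \<and> card (equidistributed_directions S) = p - 2)
       \<and> (\<forall>S T :: ('a ^ 2) set.
            card S = p * (p - 1) div 2 \<and> card (equidistributed_directions S) = p - 2 \<and>
            card T = p * (p - 1) div 2 \<and> card (equidistributed_directions T) = p - 2
            \<longrightarrow> (\<exists>g \<in> AGL2. g ` S = T))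
       \<and> (\<forall>S T :: ('a ^ 2) set.
            card S = p * (p - 1) div 2 \<and> card (equidistributed_directions S) = p - 2 \<and>
            card (special_directions T) = 3
            \<longrightarrow> (\<exists>g \<in> AGL2. g ` T = S \<or> g ` T = - S))"
proof -
  have prime: "prime CARD('a)" using assms by simp
  have transport: "\<exists>k\<in>AGL2. k ` (g ` A) = h ` A" if "g \<in> AGL2" "h \<in> AGL2" for g h :: "'a ^ 2 \<Rightarrow> 'a ^ 2" and A
  proof
    show "h \<circ> inv g \<in> AGL2" using that by (intro AGL2_comp AGL2_inv)
    show "(h \<circ> inv g) ` (g ` A) = h ` A"
      using bij_is_inj[OF AGL2_bij[OF that(1)]] by (simp only: image_comp[symmetric] image_inv_f_f)
  qed
  have "card (equidistributed_directions (carry_set :: ('a ^ 2) set)) = p - 2"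
    using card_equidistributed_plus_special[of "carry_set :: ('a ^ 2) set"]
    by (simp add: card_special_directions_carry_set[OF prime] assms(2))
  moreover have "card (carry_set :: ('a ^ 2) set) = p * (p - 1) div 2"
    using card_carry_set[OF prime] assms(2) by simp
  ultimately have "\<exists>S :: ('a ^ 2) set. card S = p * (p - 1) div 2 \<and> card (equidistributed_directions S) = p - 2"
    by blast
  moreover have "\<exists>g\<in>AGL2. g ` S = T"
    if "card S = p * (p - 1) div 2" "card (equidistributed_directions S) = p - 2"
      "card T = p * (p - 1) div 2" "card (equidistributed_directions T) = p - 2" for S T :: "('a ^ 2) set"
    using AGL2_image_of_carry_set[OF prime, of S] AGL2_image_of_carry_set[OF prime, of T] that transport
    unfolding assms(2) by metis
  moreover have "\<exists>g\<in>AGL2. g ` T = S \<or> g ` T = - S"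
    if S: "card S = p * (p - 1) div 2" "card (equidistributed_directions S) = p - 2"
      and T: "card (special_directions T) = 3" for S T :: "('a ^ 2) set"
  proof -
    obtain h where h: "h \<in> AGL2" "h ` carry_set = S"
      using AGL2_image_of_carry_set[OF prime, of S] S unfolding assms(2) by blast
    obtain g where g: "g \<in> AGL2" "g ` carry_set = T \<or> g ` carry_set = - T"
      using three_special_directions[OF prime T] by blast
    obtain k where k: "k \<in> AGL2" "k ` (g ` carry_set) = S"
      using transport[OF g(1) h(1)] h(2) by metis
    \<comment> \<open>A bijection commutes with complements, so if the carry set is mapped to the
      complement of \<open>T\<close>, then \<open>k\<close> sends \<open>T\<close> to the complement
      of \<open>S\<close>.\<close>
    have "k ` (- T) = S \<Longrightarrow> k ` T = - S"
      using bij_image_Compl_eq[OF AGL2_bij[OF k(1)], of T] by auto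
    then have "k ` T = S \<or> k ` T = - S" using g k by metis
    with k(1) show ?thesis by blast
  qed
  ultimately show ?thesis by blast
qed

end
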